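(* Let $p$ be a prime, let $q=p^a$, let $b\geq 1$ be a divisor of $a$ with $b\neq a$, let $n\geq 3$ be odd, and let $M=\frac{q^n+1}{q+1}$. Let $S'$ be the numerical semigroup generated by $$\{\,q^n+1-iM-j \;:\; i,j\in\mathbb{Z}_{\geq 0},\ 0\leq iM+jq^2\leq q^{n-1}p^b\,\}.$$ Then the genus of $S'$ is $\dfrac{q^{n+2}-p^bq^n-q^3+q^2}{2p^b}$.
   Context: The genus of a numerical semigroup is the number of non-negative integers not belonging to it. *)

theory Defs
  imports Complex_Main "HOL-Computational_Algebra.Primes"
begin

definition numerical_semigroup :: "nat set \<Rightarrow> bool" where
  "numerical_semigroup S \<longleftrightarrow>
     0 \<in> S \<and> (\<forall>x\<in>S. \<forall>y\<in>S. x + y \<in> S) \<and> finite (- S)"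

inductive_set semigroup_generated :: "nat set \<Rightarrow> nat set" for G where
  zero: "0 \<in> semigroup_generated G"
| gen: "g \<in> G \<Longrightarrow> g \<in> semigroup_generated G"
| add: "x \<in> semigroup_generated G \<Longrightarrow> y \<in> semigroup_generated G \<Longrightarrow>
    x + y \<in> semigroup_generated G"

text \<open>The genus is the number of gaps. It is only meaningful when the complement is finite
  (\<^const>\<open>card\<close> is 0 on infinite sets), so it should be used together with
  \<^const>\<open>numerical_semigroup\<close>.\<close>

definition genus :: "nat set \<Rightarrow> nat" where
  "genus S = card (- S)"

text \<open>The generators, written as natural numbers obtained from an integer equation so that
  no truncated subtraction is involved. If \<open>q = p ^ a\<close> and \<open>b < a\<close>, then
  \<open>i * M + j \<le> q ^ (n - 1) * p ^ b < q ^ n\<close>, so every admissible pair \<open>(i, j)\<close>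
  contributes a (positive) generator.\<close>

definition S'_generators :: "nat \<Rightarrow> nat \<Rightarrow> nat \<Rightarrow> nat \<Rightarrow> nat \<Rightarrow> nat set" where
  "S'_generators p q b n M =
     {m. \<exists>i j :: nat. int m = int q ^ n + 1 - int i * int M - int j \<and>
                      i * M + j * q\<^sup>2 \<le> q ^ (n - 1) * p ^ b}"

end

theory Submission
  imports Defs
begin

text \<open>
  Write \<open>P = p ^ b\<close>, \<open>c = q / P\<close>, \<open>r = q ^ (n - 3)\<close> and \<open>m = (q * r + 1) / (q + 1)\<close>, so that
  \<open>q ^ n + 1 = (q + 1) * M\<close> and \<open>M = q\<^sup>2 * m - q + 1\<close>. Because \<open>M\<close> is so close to
  \<open>q\<^sup>2 * m\<close>, the condition \<open>i * M + j * q\<^sup>2 \<le> q ^ (n - 1) * P\<close> on the generators is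
  equivalent to \<open>i * m + j \<le> P * r\<close>, and it forces \<open>i \<le> P\<close> (\<open>gens_condition\<close>). In this form
  the sums of \<open>k\<close> generators are visible: they are the numbers \<open>((q + 1) * k - i) * M - j\<close> with
  \<open>0 \<le> i \<le> k * P\<close>, \<open>0 \<le> j\<close> and \<open>i * m + j \<le> k * P * r\<close>. The semigroup is therefore a union
  of intervals, each ending at a multiple of \<open>M\<close> and reaching
  \<open>depth k i = k * P * r - i * m\<close> below it.

  Every positive integer is uniquely \<open>u * M - s\<close> with \<open>0 \<le> s < M\<close>, and \<open>u\<close> is uniquely
  \<open>(q + 1) * k - i\<close> with \<open>k \<ge> 1\<close> and \<open>0 \<le> i \<le> q\<close>. In these coordinates the number belongs to the
  semigroup exactly if \<open>s \<le> depth k i\<close> (\<open>mem_iff\<close>): other ways of writing \<open>u\<close>, and intervals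
  ending at larger multiples of \<open>M\<close>, never reach further down. No gap has \<open>k \<ge> q * c\<close>, so the
  gaps are the lattice points above the plane \<open>s = depth k i\<close> in the box \<open>1 \<le> k < q * c\<close>,
  \<open>0 \<le> i \<le> q\<close>, \<open>0 \<le> s < M\<close>.

  The point reflection \<open>(k, i, s) \<mapsto> (q * c - k, q - i, M - 1 - s)\<close> of the box preserves the plane
  (\<open>depth_dual\<close>), hence exchanges the points above it with those below. Thus twice the genus is the
  size of the box minus the number of points on the plane. The columns \<open>(k, i)\<close> that the plane
  misses inside the box are those with \<open>depth k i < 0\<close>, which means \<open>k * P < i\<close>, and their
  reflections; the former form a triangle with \<open>q * (c - 1) / 2\<close> elements. This gives
  \<open>2 * genus = (q * c - 1) * (q + 1) * (M - 1) + q * (c - 1)\<close> (\<open>genus_formula\<close>), and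
  multiplying by \<open>P\<close> yields the stated formula.
\<close>

section \<open>Division with remainder counted downwards\<close>

lemma ceiling_remainder_unique:
  fixes d k l s t :: int
  assumes "d * k - s = d * l - t" "0 \<le> s" "s < d" "0 \<le> t" "t < d"
  shows "k = l \<and> s = t"
proof -
  have "k = (d * k - s + (d - 1)) div d" using assms
    by (intro int_div_pos_eq[symmetric, where r = "d - 1 - s"]) (auto simp: algebra_simps)
  moreover have "l = (d * l - t + (d - 1)) div d" using assms
    by (intro int_div_pos_eq[symmetric, where r = "d - 1 - t"]) (auto simp: algebra_simps)
  ultimately show ?thesis using assms by auto
qed

lemma ceiling_remainder_exists:
  fixes d x :: int
  assumes "d \<ge> 1" "x \<ge> 1"
  shows "\<exists>k s. 1 \<le> k \<and> 0 \<le> s \<and> s < d \<and> x = d * k - s"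
proof (intro exI conjI)
  show "1 \<le> (x - 1) div d + 1" using assms by (simp add: pos_imp_zdiv_nonneg_iff)
  show "0 \<le> d - 1 - (x - 1) mod d" using assms pos_mod_bound[of d "x - 1"] by simp
  show "d - 1 - (x - 1) mod d < d" using assms pos_mod_sign[of d "x - 1"] by linarith
  show "x = d * ((x - 1) div d + 1) - (d - 1 - (x - 1) mod d)"
    using mult_div_mod_eq[of d "x - 1"] by (simp add: algebra_simps)
qed

section \<open>The parameters\<close>

text \<open>Here \<open>P = p ^ b\<close>, \<open>c = q / P\<close> and \<open>r = q ^ (n - 3)\<close>. Working over the integers avoids
  truncated subtraction, and the two product equations replace the divisions that define \<open>m\<close> and
  \<open>M\<close>.\<close>

locale staircase =
  fixes P c r m q M :: int
  assumes P: "P \<ge> 1" and c: "c \<ge> 2" and r: "r \<ge> 1"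
    and q: "q = P * c"
    and m: "(q + 1) * m = q * r + 1"
    and M: "M = q\<^sup>2 * m - q + 1"
begin

definition gens :: "nat set" where
  "gens = {x. \<exists>i j. 0 \<le> i \<and> 0 \<le> j \<and> int x = (q + 1) * M - i * M - j \<and>
     i * M + j * q\<^sup>2 \<le> q\<^sup>2 * r * P}"

definition depth :: "int \<Rightarrow> int \<Rightarrow> int" where
  "depth k i = k * P * r - i * m"

lemma P_less_q: "P < q"
proof -
  have "P * 1 < P * c" using P c by (intro mult_strict_left_mono) auto
  then show ?thesis using q by simp
qed

lemma q_ge2: "q \<ge> 2" using P_less_q P by simp

lemma m_ge1: "m \<ge> 1"
proof (rule ccontr)
  assume "\<not> m \<ge> 1"
  then have "(q + 1) * m \<le> 0" using q_ge2 by (simp add: mult_nonneg_nonpos)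
  moreover have "q * r \<ge> 0" using q_ge2 r by simp
  ultimately show False using m by linarith
qed

lemma m_le_r: "m \<le> r"
proof -
  have "(q + 1) * m \<le> (q + 1) * r" using m r by (simp add: algebra_simps)
  then show ?thesis using q_ge2 by simp
qed

lemma m_le_M: "m \<le> M"
proof -
  have "(q - 1) * 1 \<le> (q - 1) * ((q + 1) * m)"
    using q_ge2 m_ge1 mult_mono[of 1 "q+1" 1 m] by (intro mult_left_mono) auto
  then show ?thesis using M by (simp add: algebra_simps power2_eq_square)
qed

lemma M_ge1: "M \<ge> 1" using m_le_M m_ge1 by simp

lemma M_alt: "(q + 1) * M = q\<^sup>2 * (q * r) + 1"
proof -
  have "(q + 1) * M = q\<^sup>2 * ((q + 1) * m) - (q + 1) * (q - 1)"
    unfolding M by (simp add: algebra_simps)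
  also have "\<dots> = q\<^sup>2 * (q * r) + 1" unfolding m by (simp add: algebra_simps power2_eq_square)
  finally show ?thesis .
qed

text \<open>The value of \<open>depth k\<close> at \<open>i = k * P\<close> is \<open>k * P * (r - m) \<ge> 0\<close>, where
  \<open>(q + 1) * (r - m) = r - 1\<close>; one step further it is negative provided that \<open>k * P < q\<close>, which
  \<open>i \<le> q\<close> guarantees. So, in this range, the bound \<open>i \<le> k * P\<close> for sums of \<open>k\<close> generators says
  no more than that the interval attached to \<open>(k, i)\<close> is nonempty.\<close>

lemma depth_nonneg_iff:
  assumes "0 \<le> i" "i \<le> q" "0 \<le> k"
  shows "0 \<le> depth k i \<longleftrightarrow> i \<le> k * P"
proof
  assume "i \<le> k * P"
  then have "i * m \<le> (k * P) * r" using assms m_ge1 m_le_r by (intro mult_mono) auto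
  then show "0 \<le> depth k i" by (simp add: depth_def)
next
  assume d: "0 \<le> depth k i"
  show "i \<le> k * P"
  proof (rule ccontr)
    assume "\<not> i \<le> k * P"
    then have e: "k * P + 1 \<le> i" by simp
    let ?e = "k * P"
    have "(?e + 1) * m \<le> i * m" using e m_ge1 by (intro mult_right_mono) auto
    then have "(?e + 1) * m \<le> ?e * r" using d by (simp add: depth_def)
    then have "(q + 1) * ((?e + 1) * m) \<le> (q + 1) * (?e * r)"
      using q_ge2 by (intro mult_left_mono) auto
    moreover have "(q + 1) * ((?e + 1) * m) = (?e + 1) * (q * r + 1)"
      using m by (metis mult.left_commute)
    ultimately have "q * r + ?e + 1 \<le> ?e * r" by (simp add: algebra_simps)
    moreover have "?e * r \<le> q * r" using e assms r by (intro mult_right_mono) auto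
    moreover have "?e \<ge> 0" using assms P by simp
    ultimately show False by linarith
  qed
qed

text \<open>The reflection symmetry behind the genus count; it comes from
  \<open>q * c * P * r - q * m = q\<^sup>2 * r - q * m = M - 1\<close>.\<close>

lemma depth_dual: "depth (q * c - k) (q - i) = M - 1 - depth k i"
proof -
  have "depth (q * c - k) (q - i) + depth k i = q * (P * c) * r - q * m"
    unfolding depth_def by (simp add: algebra_simps)
  also have "\<dots> = q * (q * r + 1) - q - q * m"
    unfolding q[symmetric] by (simp add: algebra_simps)
  also have "\<dots> = M - 1"
    unfolding m[symmetric] M by (simp add: algebra_simps power2_eq_square)
  finally show ?thesis by simp
qed

section \<open>The semigroup as a union of intervals\<close>

text \<open>Since \<open>M = q\<^sup>2 * m - (q - 1)\<close>, dividing the condition on the left by \<open>q\<^sup>2\<close> leaves an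
  error \<open>i * (q - 1) / q\<^sup>2\<close>, which is below 1 once \<open>i \<le> P < q\<close> is known and so disappears for
  integers.\<close>

lemma gens_condition:
  assumes "0 \<le> i" "0 \<le> j"
  shows "i * M + j * q\<^sup>2 \<le> q\<^sup>2 * r * P \<longleftrightarrow> i \<le> P \<and> i * m + j \<le> P * r"
proof
  assume h: "i * M + j * q\<^sup>2 \<le> q\<^sup>2 * r * P"
  have q2: "q\<^sup>2 > 0" using q_ge2 by simp
  have iP: "i \<le> P"
  proof (rule ccontr)
    assume "\<not> i \<le> P"
    then have "(P + 1) * M \<le> i * M" using M_ge1 by (intro mult_right_mono) auto
    moreover have "0 \<le> j * q\<^sup>2" using assms by simp
    ultimately have "(P + 1) * M \<le> q\<^sup>2 * r * P" using h by linarith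
    then have "(q + 1) * ((P + 1) * M) \<le> (q + 1) * (q\<^sup>2 * r * P)"
      using q_ge2 by (intro mult_left_mono) auto
    then have "(P + 1) * (q\<^sup>2 * (q * r) + 1) \<le> (q + 1) * (q\<^sup>2 * r * P)"
      using M_alt by (metis mult.left_commute)
    then have "q\<^sup>2 * r * q + P + 1 \<le> q\<^sup>2 * r * P" by (simp add: algebra_simps)
    moreover have "q\<^sup>2 * r * P \<le> q\<^sup>2 * r * q" using P_less_q r by (intro mult_left_mono) auto
    ultimately show False using P by linarith
  qed
  have "i * (q - 1) \<le> q * (q - 1)" using iP P_less_q q_ge2 by (intro mult_right_mono) auto
  also have "\<dots> < q\<^sup>2" using q_ge2 by (simp add: algebra_simps power2_eq_square)
  finally have b: "i * (q - 1) < q\<^sup>2" .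
  have "q\<^sup>2 * (i * m + j) - i * (q - 1) \<le> q\<^sup>2 * (P * r)"
    using h unfolding M by (simp add: algebra_simps)
  then have "q\<^sup>2 * (i * m + j) < q\<^sup>2 * (P * r + 1)" using b by (simp add: algebra_simps)
  then show "i \<le> P \<and> i * m + j \<le> P * r" using iP q2 by simp
next
  assume h: "i \<le> P \<and> i * m + j \<le> P * r"
  have "i * M \<le> i * (q\<^sup>2 * m)" unfolding M using assms q_ge2 by (intro mult_left_mono) auto
  then have "i * M + j * q\<^sup>2 \<le> q\<^sup>2 * (i * m + j)" by (simp add: algebra_simps)
  also have "\<dots> \<le> q\<^sup>2 * (P * r)" using h by (intro mult_left_mono) auto
  finally show "i * M + j * q\<^sup>2 \<le> q\<^sup>2 * r * P" by (simp add: algebra_simps)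
qed

lemma generator_exists:
  assumes "0 \<le> i" "0 \<le> j" "i \<le> P" "i * m + j \<le> P * r"
  shows "\<exists>x\<in>gens. int x = (q + 1 - i) * M - j"
proof -
  have h: "i * M + j * q\<^sup>2 \<le> q\<^sup>2 * r * P" using gens_condition assms by blast
  have "j * 1 \<le> j * q\<^sup>2" using assms q_ge2 by (intro mult_left_mono) (auto simp: int_one_le_iff_zero_less)
  moreover have "q\<^sup>2 * r * P \<le> q\<^sup>2 * r * q" using P_less_q r by (intro mult_left_mono) auto
  ultimately have "(q + 1) * M - i * M - j \<ge> 0" using h M_alt by (simp add: algebra_simps)
  then have "int (nat ((q + 1) * M - i * M - j)) = (q + 1) * M - i * M - j" by simp
  moreover from this have "nat ((q + 1) * M - i * M - j) \<in> gens"
    using h assms unfolding gens_def by blast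
  ultimately show ?thesis by (intro bexI) (auto simp: algebra_simps)
qed

text \<open>A sum of \<open>k + 1\<close> generators is split greedily: the first one takes as much of \<open>i\<close> as
  possible, then as much of \<open>j\<close> as still fits. If the first one is full, the rest satisfies the
  bound for \<open>k\<close> by subtraction; if not, nothing is left of \<open>j\<close> and the bound follows from
  \<open>m \<le> r\<close>.\<close>

lemma generated_if:
  assumes "0 \<le> i" "0 \<le> j" "i \<le> int k * P" "i * m + j \<le> int k * P * r"
  shows "\<exists>x \<in> semigroup_generated gens. int x = ((q + 1) * int k - i) * M - j"
  using assms
proof (induction k arbitrary: i j)
  case 0
  moreover have "0 \<in> semigroup_generated gens" by (rule semigroup_generated.zero)
  ultimately show ?case by (intro bexI[of _ 0]) auto
next
  case (Suc k)
  define i1 where "i1 = min i P"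
  define j1 where "j1 = min j (P * r - i1 * m)"
  have i1: "0 \<le> i1" "i1 \<le> P" using Suc.prems P by (auto simp: i1_def)
  have "i1 * m \<le> P * r" using i1 m_ge1 m_le_r by (intro mult_mono) auto
  then have j1: "0 \<le> j1" "i1 * m + j1 \<le> P * r" using Suc.prems by (auto simp: j1_def)
  obtain x where x: "x \<in> gens" "int x = (q + 1 - i1) * M - j1"
    using generator_exists[OF i1(1) j1(1) i1(2) j1(2)] by blast
  have i2: "0 \<le> i - i1" by (simp add: i1_def)
  have i2': "i - i1 \<le> int k * P"
    using Suc.prems(3) P by (auto simp: i1_def min_def algebra_simps)
  have "(i - i1) * m \<le> (int k * P) * r" using i2 i2' m_ge1 m_le_r P by (intro mult_mono) auto
  then have "(i - i1) * m + (j - j1) \<le> int k * P * r"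
    using Suc.prems(4) by (auto simp: j1_def min_def algebra_simps)
  moreover have "0 \<le> j - j1" by (simp add: j1_def)
  ultimately obtain y where y: "y \<in> semigroup_generated gens"
      "int y = ((q + 1) * int k - (i - i1)) * M - (j - j1)"
    using Suc.IH i2 i2' by blast
  have "x + y \<in> semigroup_generated gens"
    by (rule semigroup_generated.add[OF semigroup_generated.gen[OF x(1)] y(1)])
  moreover have "int (x + y) = ((q + 1) * int (Suc k) - i) * M - j"
    using x y by (simp add: algebra_simps)
  ultimately show ?case by blast
qed

lemma generated_only_if:
  assumes "x \<in> semigroup_generated gens"
  shows "\<exists>k i j. 0 \<le> k \<and> 0 \<le> i \<and> 0 \<le> j \<and> i \<le> k * P \<and> i * m + j \<le> k * P * r \<and>
    int x = ((q + 1) * k - i) * M - j"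
  using assms
proof induction
  case zero
  show ?case by (intro exI[of _ 0]) auto
next
  case (gen g)
  then obtain i j where "0 \<le> i" "0 \<le> j" "int g = (q + 1) * M - i * M - j"
      "i * M + j * q\<^sup>2 \<le> q\<^sup>2 * r * P" unfolding gens_def by blast
  then show ?case using gens_condition[of i j]
    by (intro exI[of _ 1] exI[of _ i] exI[of _ j]) (auto simp: algebra_simps)
next
  case (add x y)
  then obtain k i j k' i' j' where
    "0 \<le> k" "0 \<le> i" "0 \<le> j" "i \<le> k * P" "i * m + j \<le> k * P * r"
    "int x = ((q + 1) * k - i) * M - j"
    "0 \<le> k'" "0 \<le> i'" "0 \<le> j'" "i' \<le> k' * P" "i' * m + j' \<le> k' * P * r"
    "int y = ((q + 1) * k' - i') * M - j'" by blast
  then show ?case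
    by (intro exI[of _ "k + k'"] exI[of _ "i + i'"] exI[of _ "j + j'"]) (auto simp: algebra_simps)
qed

text \<open>In a representation of \<open>x\<close> with other parameters \<open>k'\<close>, \<open>i'\<close>, put
  \<open>u' = (q + 1) * k' - i'\<close>. The interval attached to it has length
  \<open>u' * m - k' * ((q + 1) * m - P * r)\<close>. Passing from \<open>u\<close> to a larger \<open>u'\<close> costs \<open>M\<close> per
  step and gains at most \<open>m \<le> M\<close>, and the length decreases in \<open>k'\<close>, whose least possible value
  is \<open>k\<close>. Hence no representation gives more than \<open>depth k i\<close>.\<close>

lemma mem_iff:
  assumes "1 \<le> k" "0 \<le> i" "i \<le> q" "0 \<le> s" "s < M"
    and x: "int x = ((q + 1) * k - i) * M - s"
  shows "x \<in> semigroup_generated gens \<longleftrightarrow> s \<le> depth k i"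
proof
  assume d: "s \<le> depth k i"
  then have "i \<le> k * P" using depth_nonneg_iff[of i k] assms by simp
  then have "\<exists>y \<in> semigroup_generated gens. int y = ((q + 1) * int (nat k) - i) * M - s"
    using assms d by (intro generated_if) (auto simp: depth_def)
  then obtain y where "y \<in> semigroup_generated gens" "int y = int x" using assms by auto
  then show "x \<in> semigroup_generated gens" by simp
next
  assume "x \<in> semigroup_generated gens"
  then obtain k' i' j where k': "0 \<le> i'" "0 \<le> j" "i' * m + j \<le> k' * P * r"
      "int x = ((q + 1) * k' - i') * M - j"
    using generated_only_if by blast
  define u where "u = (q + 1) * k - i"
  define u' where "u' = (q + 1) * k' - i'"
  have eq: "u * M - s = u' * M - j" using k'(4) x by (simp add: u_def u'_def)
  have uu: "u \<le> u'"
  proof (rule ccontr)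
    assume "\<not> u \<le> u'"
    then have "(u' + 1) * M \<le> u * M" using M_ge1 by (intro mult_right_mono) auto
    then show False using eq assms k' by (simp add: algebra_simps)
  qed
  have "(q + 1) * (k - 1) < u" using assms by (simp add: u_def algebra_simps)
  also have "\<dots> \<le> (q + 1) * k'" using uu k' by (simp add: u'_def)
  finally have kk: "k \<le> k'" using q_ge2 by simp
  define D where "D = (q + 1) * m - P * r"
  have "P * r \<le> q * r" using P_less_q r by (intro mult_right_mono) auto
  then have D: "D \<ge> 0" unfolding D_def m by simp
  have "j \<le> u' * m - k' * D" using k'(3) by (simp add: u'_def D_def algebra_simps)
  moreover have "k * D \<le> k' * D" using kk D by (intro mult_right_mono) auto
  moreover have "0 \<le> (u' - u) * (M - m)" using uu m_le_M by simp
  ultimately have "s \<le> u * m - k * D" using eq by (simp add: algebra_simps)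
  then show "s \<le> depth k i" by (simp add: u_def D_def depth_def algebra_simps)
qed

section \<open>Gaps as lattice points above a plane\<close>

definition coords :: "int \<times> int \<times> int \<Rightarrow> nat" where
  "coords = (\<lambda>(k, i, s). nat (((q + 1) * k - i) * M - s))"

lemma qc_gt_1: "1 < q * c"
proof -
  have "2 * 2 \<le> q * c" using q_ge2 c by (intro mult_mono) auto
  then show ?thesis by simp
qed

lemma int_coords:
  assumes "1 \<le> k" "0 \<le> i" "i \<le> q" "0 \<le> s" "s < M"
  shows "int (coords (k, i, s)) = ((q + 1) * k - i) * M - s" "coords (k, i, s) > 0"
proof -
  have "0 \<le> (q + 1) * (k - 1)" using assms q_ge2 by simp
  then have "1 \<le> (q + 1) * k - i" using assms by (simp add: algebra_simps)
  then have "1 * M \<le> ((q + 1) * k - i) * M" using M_ge1 by (intro mult_right_mono) auto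
  then show "int (coords (k, i, s)) = ((q + 1) * k - i) * M - s" "coords (k, i, s) > 0"
    using assms(5) unfolding coords_def prod.case by linarith+
qed

definition box :: "(int \<times> int \<times> int) set" where
  "box = {1..<q * c} \<times> {0..q} \<times> {0..<M}"

lemma gaps_bij:
  "bij_betw coords {(k, i, s) \<in> box. depth k i < s} (- semigroup_generated gens)"
  unfolding bij_betw_def
proof
  show "inj_on coords {(k, i, s) \<in> box. depth k i < s}"
  proof (rule inj_onI)
    fix x y
    assume "x \<in> {(k, i, s) \<in> box. depth k i < s}" "y \<in> {(k, i, s) \<in> box. depth k i < s}"
      and "coords x = coords y"
    moreover obtain k i s where x: "x = (k, i, s)" by (cases x)
    moreover obtain k' i' s' where y: "y = (k', i', s')" by (cases y)
    ultimately have b: "(k, i, s) \<in> box" "(k', i', s') \<in> box"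
      and e: "coords (k, i, s) = coords (k', i', s')" by auto
    have "M * ((q + 1) * k - i) - s = M * ((q + 1) * k' - i') - s'"
      using b int_coords(1)[of k i s] int_coords(1)[of k' i' s'] e
      by (auto simp: box_def mult.commute)
    then have u: "(q + 1) * k - i = (q + 1) * k' - i' \<and> s = s'"
      by (rule ceiling_remainder_unique) (use b in \<open>auto simp: box_def\<close>)
    have "k = k' \<and> i = i'"
      by (rule ceiling_remainder_unique[OF conjunct1[OF u]]) (use b in \<open>auto simp: box_def\<close>)
    then show "x = y" using u x y by blast
  qed
  show "coords ` {(k, i, s) \<in> box. depth k i < s} = - semigroup_generated gens"
  proof (intro equalityI subsetI)
    fix x assume "x \<in> coords ` {(k, i, s) \<in> box. depth k i < s}"
    then obtain k i s where "x = coords (k, i, s)" "(k, i, s) \<in> box" "depth k i < s" by auto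
    then show "x \<in> - semigroup_generated gens"
      using mem_iff[of k i s x] int_coords[of k i s] by (auto simp: box_def)
  next
    fix x assume x: "x \<in> - semigroup_generated gens"
    have "x \<noteq> 0" using x semigroup_generated.zero[of gens] by (intro notI) simp
    then obtain u s where u: "1 \<le> u" "0 \<le> s" "s < M" "int x = M * u - s"
      using ceiling_remainder_exists[of M "int x"] M_ge1 by (auto simp: Suc_le_eq)
    obtain k i where k: "1 \<le> k" "0 \<le> i" "i < q + 1" "u = (q + 1) * k - i"
      using ceiling_remainder_exists[of "q + 1" u] u q_ge2 by auto
    have ex: "int x = ((q + 1) * k - i) * M - s" using u k by (simp add: mult.commute)
    have d: "depth k i < s" using mem_iff[OF k(1,2) _ u(2,3) ex] x k by simp
    \<comment> \<open>At \<open>k = q * c\<close> even the shallowest column, \<open>i = q\<close>, is full, by reflecting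
      \<open>depth 0 0 = 0\<close>.\<close>
    have "k < q * c"
    proof (rule ccontr)
      assume "\<not> k < q * c"
      then have "q * c * (P * r) \<le> k * (P * r)" using P r by (intro mult_right_mono) auto
      moreover have "i * m \<le> q * m" using k m_ge1 by (intro mult_right_mono) auto
      ultimately have "depth (q * c) q \<le> depth k i" by (simp add: depth_def algebra_simps)
      moreover have "depth (q * c) q = M - 1"
        using depth_dual[of 0 0] by (simp add: depth_def)
      ultimately show False using d u by simp
    qed
    then have "(k, i, s) \<in> box" using k u by (auto simp: box_def)
    moreover have "x = coords (k, i, s)" unfolding coords_def prod.case ex[symmetric] by simp
    ultimately show "x \<in> coords ` {(k, i, s) \<in> box. depth k i < s}" using d by blast
  qed
qed

lemma finite_box: "finite box" by (simp add: box_def)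

lemma finite_gaps: "finite (- semigroup_generated gens)"
proof -
  have "finite {(k, i, s) \<in> box. depth k i < s}" by (rule finite_subset[OF _ finite_box]) auto
  then show ?thesis using bij_betw_finite[OF gaps_bij] by simp
qed

section \<open>Counting by reflection\<close>

lemma card_above_below:
  "card {(k, i, s) \<in> box. depth k i < s} = card {(k, i, s) \<in> box. s < depth k i}"
proof (rule bij_betw_same_card[of "\<lambda>(k, i, s). (q * c - k, q - i, M - 1 - s)"])
  show "bij_betw (\<lambda>(k, i, s). (q * c - k, q - i, M - 1 - s))
     {(k, i, s) \<in> box. depth k i < s} {(k, i, s) \<in> box. s < depth k i}"
    by (rule bij_betw_byWitness[where f' = "\<lambda>(k, i, s). (q * c - k, q - i, M - 1 - s)"])
      (auto simp: box_def depth_dual)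
qed

definition pairs :: "(int \<times> int) set" where
  "pairs = {1..<q * c} \<times> {0..q}"

lemma finite_pairs: "finite pairs" by (simp add: pairs_def)

text \<open>The plane is the graph of \<open>depth\<close>, so it meets each column of the box at most once.\<close>

lemma card_boundary:
  "card {(k, i, s) \<in> box. s = depth k i} = card {(k, i) \<in> pairs. 0 \<le> depth k i \<and> depth k i < M}"
  by (rule bij_betw_same_card[of "\<lambda>(k, i, s). (k, i)"],
      rule bij_betw_byWitness[where f' = "\<lambda>(k, i). (k, i, depth k i)"])
    (force simp: box_def pairs_def)+

lemma card_overflow_eq_negative:
  "card {(k, i) \<in> pairs. M \<le> depth k i} = card {(k, i) \<in> pairs. depth k i < 0}"
  by (rule bij_betw_same_card[of "\<lambda>(k, i). (q * c - k, q - i)"],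
      rule bij_betw_byWitness[where f' = "\<lambda>(k, i). (q * c - k, q - i)"])
    (force simp: pairs_def depth_dual)+

text \<open>The columns are the lattice points of a triangle: there are \<open>q - k * P = P * (c - k)\<close> of them
  for each \<open>k\<close> from 1 to \<open>c - 1\<close>. Pairing \<open>k\<close> with \<open>c - k\<close> gives \<open>P * c = q\<close> per pair.\<close>

lemma card_negative: "2 * int (card {(k, i) \<in> pairs. depth k i < 0}) = q * (c - 1)"
proof -
  have iff: "depth k i < 0 \<longleftrightarrow> k * P < i" if "(k, i) \<in> pairs" for k i
    using that depth_nonneg_iff[of i k] by (auto simp: pairs_def)
  have less: "k < c" if "k * P < i" "i \<le> q" for k i
  proof -
    have "k * P < c * P" using that q by (simp add: mult.commute)
    then show ?thesis using P by (simp add: mult_less_cancel_right)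
  qed
  have qc: "1 * c \<le> q * c" using q_ge2 c by (intro mult_right_mono) auto
  have "{(k, i) \<in> pairs. depth k i < 0} = (SIGMA k:{1..<c}. {k * P<..q})"
  proof -
    have "(k, i) \<in> pairs \<and> depth k i < 0 \<longleftrightarrow> (k, i) \<in> (SIGMA k:{1..<c}. {k * P<..q})" for k i
    proof
      assume "(k, i) \<in> pairs \<and> depth k i < 0"
      then show "(k, i) \<in> (SIGMA k:{1..<c}. {k * P<..q})"
        using iff[of k i] less[of k i] by (auto simp: pairs_def)
    next
      assume h: "(k, i) \<in> (SIGMA k:{1..<c}. {k * P<..q})"
      then have "0 \<le> k * P" using P by simp
      then have "0 \<le> i" using h by simp
      moreover have "k < q * c" by (rule less_le_trans[OF _ qc]) (use h in simp)
      ultimately have "(k, i) \<in> pairs" using h by (simp add: pairs_def)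
      then show "(k, i) \<in> pairs \<and> depth k i < 0" using iff[of k i] h by auto
    qed
    then show ?thesis by auto
  qed
  then have "int (card {(k, i) \<in> pairs. depth k i < 0}) = (\<Sum>k\<in>{1..<c}. int (nat (q - k * P)))"
    by simp
  also have "\<dots> = (\<Sum>k\<in>{1..<c}. P * (c - k))"
  proof (rule sum.cong)
    fix k assume "k \<in> {1..<c}"
    then have "0 \<le> P * (c - k)" using P by simp
    then show "int (nat (q - k * P)) = P * (c - k)" unfolding q by (simp add: algebra_simps)
  qed simp
  also have "\<dots> = (\<Sum>k\<in>{1..<c}. P * k)"
    by (rule sum.reindex_bij_witness[of _ "\<lambda>k. c - k" "\<lambda>k. c - k"]) auto
  finally have "2 * int (card {(k, i) \<in> pairs. depth k i < 0})
      = (\<Sum>k\<in>{1..<c}. P * (c - k)) + (\<Sum>k\<in>{1..<c}. P * k)"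
    using \<open>(\<Sum>k\<in>{1..<c}. P * (c - k)) = (\<Sum>k\<in>{1..<c}. P * k)\<close> by simp
  also have "\<dots> = (\<Sum>k\<in>{1..<c}. P * c)"
    by (simp add: algebra_simps flip: sum.distrib)
  also have "\<dots> = q * (c - 1)" using c q by simp
  finally show ?thesis .
qed

lemma genus_formula:
  "2 * int (genus (semigroup_generated gens)) = (q * c - 1) * (q + 1) * (M - 1) + q * (c - 1)"
proof -
  let ?above = "{(k, i, s) \<in> box. depth k i < s}"
  let ?below = "{(k, i, s) \<in> box. s < depth k i}"
  let ?boundary = "{(k, i, s) \<in> box. s = depth k i}"
  let ?neg = "{(k, i) \<in> pairs. depth k i < 0}"
  let ?mid = "{(k, i) \<in> pairs. 0 \<le> depth k i \<and> depth k i < M}"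
  let ?big = "{(k, i) \<in> pairs. M \<le> depth k i}"
  have g: "genus (semigroup_generated gens) = card ?above"
    unfolding genus_def using bij_betw_same_card[OF gaps_bij] by simp
  have fb: "finite ?above" "finite ?below" "finite ?boundary"
    by (auto intro: finite_subset[OF _ finite_box])
  have fp: "finite ?neg" "finite ?mid" "finite ?big"
    by (auto intro: finite_subset[OF _ finite_pairs])
  have "box = ?above \<union> (?below \<union> ?boundary)" by auto
  then have "card box = card (?above \<union> (?below \<union> ?boundary))" by simp
  also have "\<dots> = card ?above + (card ?below + card ?boundary)"
    using fb by (subst card_Un_disjoint, auto)+
  finally have b: "card box = card ?above + (card ?below + card ?boundary)" .
  have "pairs = ?neg \<union> (?mid \<union> ?big)" by auto
  then have "card pairs = card (?neg \<union> (?mid \<union> ?big))" by simp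
  also have "\<dots> = card ?neg + (card ?mid + card ?big)"
    using fp M_ge1 by (subst card_Un_disjoint, auto)+
  finally have p: "card pairs = card ?neg + (card ?mid + card ?big)" .
  have cp: "int (card pairs) = (q * c - 1) * (q + 1)"
    using qc_gt_1 q_ge2 by (simp add: pairs_def card_cartesian_product)
  have cb: "int (card box) = (q * c - 1) * (q + 1) * M"
    using qc_gt_1 q_ge2 M_ge1 by (simp add: box_def card_cartesian_product)
  have "2 * int (card ?above) = int (card box) - int (card pairs) + 2 * int (card ?neg)"
    using b p card_above_below card_boundary card_overflow_eq_negative by linarith
  then show ?thesis unfolding g cb cp card_negative by (simp add: algebra_simps)
qed

end

section \<open>The genus\<close>

theorem theoremB10:
  fixes p q a b n M :: nat and S' :: "nat set"
  assumes "prime p"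
    and "a \<ge> 1"
    and "q = p ^ a"
    and "b \<ge> 1" and "b dvd a" and "b \<noteq> a"
    and "n \<ge> 3" and "odd n"
    and "real M = (real q ^ n + 1) / (real q + 1)"
    and "S' = semigroup_generated (S'_generators p q b n M)"
  shows "numerical_semigroup S' \<and>
    real (genus S') =
      (real q ^ (n + 2) - real p ^ b * real q ^ n - real q ^ 3 + real q ^ 2) / (2 * real p ^ b)"
proof -
  have p2: "p \<ge> 2" using assms(1) by (rule prime_ge_2_nat)
  have "b < a" using assms by (meson dvd_imp_le le_neq_implies_less less_le_trans zero_less_one)
  define t where "t = n - 3"
  have n: "n = t + 3" using assms(7) by (simp add: t_def)
  define c where "c = p ^ (a - b)"
  define r where "r = q ^ t"
  have qPc: "q = p ^ b * c" using \<open>b < a\<close> assms(3) by (simp add: c_def flip: power_add)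
  have "p ^ 1 \<le> p ^ (a - b)" using \<open>b < a\<close> p2 by (intro power_increasing) auto
  then have c2: "c \<ge> 2" using p2 by (simp add: c_def)
  have q0: "q > 0" using assms(3) p2 by simp
  have "real ((q + 1) * M) = real (q ^ n + 1)" using assms(9) by (simp add: field_simps)
  then have MM: "(q + 1) * M = q ^ n + 1" by (simp only: of_nat_eq_iff)
  have "q\<^sup>2 * (q * r + 1) + 1 = (q + 1) * M + q\<^sup>2" unfolding MM
    by (simp add: n r_def algebra_simps power_add power2_eq_square power3_eq_cube)
  then have "int (q\<^sup>2 * (q * r + 1) + 1) = int ((q + 1) * M + q\<^sup>2)" by (rule arg_cong)
  then have e: "int q ^ 2 * (int q * int r + 1) = (int q + 1) * (int M + int q - 1)"
    by (simp add: algebra_simps power2_eq_square)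
  \<comment> \<open>As \<open>q\<^sup>2\<close> is coprime to \<open>q + 1\<close>, integrality of \<open>M\<close> passes down from \<open>q ^ n + 1\<close> to
    \<open>q ^ (n - 2) + 1 = q * r + 1\<close>.\<close>
  have "coprime (int q + 1) (int q ^ 2)" by simp
  then have "(int q + 1) dvd (int q * int r + 1)"
    using e by (metis coprime_dvd_mult_right_iff dvd_triv_left)
  then obtain m where m: "int q * int r + 1 = (int q + 1) * m" by blast
  have "(int q + 1) * (int q ^ 2 * m) = (int q + 1) * (int M + int q - 1)"
    using e m by (metis mult.left_commute)
  then have Mm: "int M = int q ^ 2 * m - int q + 1" by simp
  interpret staircase "int (p ^ b)" "int c" "int r" m "int q" "int M"
  proof
    show "1 \<le> int (p ^ b)" using p2 by (simp add: int_one_le_iff_zero_less)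
    show "2 \<le> int c" using c2 by simp
    show "1 \<le> int r" using q0 by (simp add: r_def int_one_le_iff_zero_less)
    show "int q = int (p ^ b) * int c" using qPc by simp
  qed (use m Mm in auto)
  have gens: "S'_generators p q b n M = gens"
  proof -
    have N: "int q ^ n + 1 = (int q + 1) * int M"
    proof -
      have "int (q ^ n + 1) = int ((q + 1) * M)" using MM by simp
      then show ?thesis by (simp add: algebra_simps)
    qed
    have Q: "q ^ (n - 1) = q\<^sup>2 * r" by (simp add: n r_def power2_eq_square)
    have C: "i * M + j * q\<^sup>2 \<le> q ^ (n - 1) * p ^ b \<longleftrightarrow>
        int i * int M + int j * (int q)\<^sup>2 \<le> (int q)\<^sup>2 * int r * int (p ^ b)" for i j
      unfolding Q by (simp flip: of_nat_mult of_nat_add of_nat_power)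
    show ?thesis
    proof (intro equalityI subsetI)
      fix x assume "x \<in> S'_generators p q b n M"
      then obtain i j where "int x = int q ^ n + 1 - int i * int M - int j"
        "i * M + j * q\<^sup>2 \<le> q ^ (n - 1) * p ^ b" unfolding S'_generators_def by blast
      then show "x \<in> gens" unfolding gens_def N C
        by (intro CollectI exI[of _ "int i"] exI[of _ "int j"]) auto
    next
      fix x assume "x \<in> gens"
      then obtain i j where "0 \<le> i" "0 \<le> j" "int x = (int q + 1) * int M - i * int M - j"
        "i * int M + j * (int q)\<^sup>2 \<le> (int q)\<^sup>2 * int r * int (p ^ b)" unfolding gens_def by blast
      then show "x \<in> S'_generators p q b n M" unfolding S'_generators_def N C
        by (intro CollectI exI[of _ "nat i"] exI[of _ "nat j"]) auto
    qed
  qed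
  have S: "S' = semigroup_generated gens" using assms(10) gens by simp
  have ns: "numerical_semigroup S'"
    unfolding numerical_semigroup_def S using finite_gaps
    by (auto intro: semigroup_generated.intros)
  define P where "P = real p ^ b"
  have P0: "P > 0" using p2 by (simp add: P_def)
  have qr: "real q = P * real c" unfolding P_def using qPc by simp
  have MR: "(real q + 1) * real M = real q ^ n + 1" using assms(9) by (simp add: field_simps)
  have "of_int (2 * int (genus S')) = (of_int ((int q * int c - 1) * (int q + 1) * (int M - 1)
      + int q * (int c - 1)) :: real)"
    using genus_formula S by simp
  then have "2 * real (genus S') = (real q * real c - 1) * ((real q + 1) * real M - (real q + 1))
      + real q * (real c - 1)" by (simp add: algebra_simps)
  then have "P * (2 * real (genus S')) = P * ((real q * real c - 1) * (real q ^ n - real q)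
      + real q * (real c - 1))" unfolding MR by simp
  also have "\<dots> = (real q * (P * real c) - P) * (real q ^ n - real q) + real q * (P * real c - P)"
    by (simp add: algebra_simps)
  also have "\<dots> = real q ^ (n + 2) - P * real q ^ n - real q ^ 3 + real q ^ 2"
    unfolding qr[symmetric] by (simp add: algebra_simps power2_eq_square power3_eq_cube power_add)
  finally show ?thesis using ns P0 unfolding P_def[symmetric] by (simp add: field_simps)
qed

end
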